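(* Let $f:\mathbb R^n\to\mathbb R$ be continuously differentiable, $A\in\mathbb R^{m\times n}$ with $m\le n$, $\mathbf b\in\mathbb R^m$, and let $s<m$ be a positive integer. Let $\mathbf w^*=(\mathbf x^*;\boldsymbol\lambda^* )$ be a $\tau$-stationary point of the problem $$(\mathrm P)\qquad \min_{\mathbf x\in\mathbb R^n} f(\mathbf x)\quad\text{s.t.}\quad \|(A\mathbf x-\mathbf b)_+\|_0\le s,$$ with $0<\tau<\tau_*$, let $J_*=\{i\in\{1,\dots,m\}:(A\mathbf x^*-\mathbf b)_i=0\}$, and assume: (i) $f$ is twice continuously differentiable on $\mathbb R^n$, $\nabla^2 f(\mathbf x^* )$ is positive definite and $A_{J_*}$ has full row rank; (ii) $\nabla^2 f$ is locally Lipschitz continuous around $\mathbf x^*$ with constant $L_*>0$, i.e. $\|\nabla^2 f(\mathbf x)-\nabla^2 f(\mathbf x')\|\le L_*\|\mathbf x-\mathbf x'\|$ for all $\mathbf x,\mathbf x'$ in a neighbourhood of $\mathbf x^*$. Then there exists $\delta_*>0$ such that, if the initial point satisfies $\mathbf w^0\in U(\mathbf w^*,\min\{\delta_*,1/(c_*L_* )\})$, every sequence $\{\mathbf w^k\}$ generated by the method NHS from $\mathbf w^0$ satisfies: a) the sequence of directions $\{\mathbf d^k\}_{k\ge0}$ is well defined and $\lim_{k\to\infty}\mathbf d^k=0$; b) the whole sequence $\{\mathbf w^k\}$ converges to $\mathbf w^*$ quadratically, namely $$\|\mathbf w^{k+1}-\mathbf w^*\|\le 0.5\,c_*L_*\|\mathbf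 w^k-\mathbf w^*\|^2\quad\text{for all }k\ge 0.$$
   Context: For $\mathbf u\in\mathbb R^m$, $\mathbf u_+$ is the entrywise positive part, $\|\cdot\|_0$ counts nonzero entries, $u_{[s]}$ is the $s$th largest element of $\mathbf u_+$ (zero if $\|\mathbf u_+\|_0<s$). $\|\cdot\|$ is the Euclidean norm for vectors, the spectral norm for matrices; $\sigma_{\min}$ is the smallest singular value; $U(\mathbf w,\epsilon)$ is the open ball of radius $\epsilon$. $A_J,\mathbf u_J$ are rows/entries indexed by $J$, $\overline J$ is the complement in $\{1,\dots,m\}$. $\tau$-stationarity: let $S=\{\mathbf u\in\mathbb R^m:\|\mathbf u_+\|_0\le s\}$ and $\mathbb P_S(\mathbf z)=\operatorname{argmin}\{\|\mathbf z-\mathbf u\|:\mathbf u\in S\}$ (the set of minimizers). $(\mathbf x^*;\boldsymbol\lambda^* )$ is a $\tau$-stationary point of $(\mathrm P)$ if $\nabla f(\mathbf x^* )+A^\top\boldsymbol\lambda^*=0$ and $A\mathbf x^*-\mathbf b\in\mathbb P_S(A\mathbf x^*-\mathbf b+\tau\boldsymbol\lambda^* )$. Constants: $\mathbf y^*=A\mathbf x^*-\mathbf b$; $\tau_*=y^*_{[s]}/\max_i\lambda_i^*$ if $\boldsymbol\lambda^*\ne0$ and $\tau_*=+\infty$ if $\boldsymbol\lambda^*=0$; for $J\subseteq\{1,\dots,m\}$, $H(J)=\begin{bmatrix}\nabla^2 f(\mathbf x^* )&A_J^\top\\ A_J&0\end{bmatrix}$; $c_*=2/\min\{\min_{J\subseteq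 J_*}\sigma_{\min}(H(J)),1\}$. Index sets: for $\mathbf z\in\mathbb R^m$ put $\Gamma_+=\{i:z_i>0\}$, $\Gamma_0=\{i:z_i=0\}$; $\mathbb T(\mathbf z;s)$ is the collection of all $T=(\Gamma_+\setminus\Gamma_s)\cup\Gamma_0$ where $\Gamma_s$ ranges over all subsets of $\Gamma_+$ with $|\Gamma_s|=\min\{s,|\Gamma_+|\}$ and $z_i\ge z_j\ge0$ for all $i\in\Gamma_s$, $j\in T$. Method NHS: given $\mathbf w^k=(\mathbf x^k;\boldsymbol\lambda^k)\in\mathbb R^n\times\mathbb R^m$, put $\mathbf z^k=A\mathbf x^k-\mathbf b+\tau\boldsymbol\lambda^k$, pick any $T_k\in\mathbb T(\mathbf z^k;s)$, let $\mathbf d^k=(\mathbf u^k;\mathbf v^k)\in\mathbb R^n\times\mathbb R^m$ be the solution of $$\begin{bmatrix}\nabla^2 f(\mathbf x^k)&A_{T_k}^\top&0\\ A_{T_k}&0&0\\ 0&0&I\end{bmatrix}\begin{bmatrix}\mathbf u^k\\ \mathbf v^k_{T_k}\\ \mathbf v^k_{\overline T_k}\end{bmatrix}=-\begin{bmatrix}\nabla f(\mathbf x^k)+A_{T_k}^\top\boldsymbol\lambda^k_{T_k}\\ A_{T_k}\mathbf x^k-\mathbf b_{T_k}\\ \boldsymbol\lambda^k_{\overline T_k}\end{bmatrix},$$ and set $\mathbf w^{k+1}=\mathbf w^k+\mathbf d^k$, for $k=0,1,2,\dots$. "$\mathbf d^k$ is well defined" means that the linear system at $\mathbf w^k$ has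 a unique solution. *)

theory Defs
  imports "HOL-Analysis.Analysis" "HOL-Library.Multiset"
begin

definition gradient :: "(real^'n \<Rightarrow> real) \<Rightarrow> real^'n \<Rightarrow> real^'n" where
  "gradient f x = (\<chi> i. frechet_derivative f (at x) (axis i 1))"

definition hessian :: "(real^'n \<Rightarrow> real) \<Rightarrow> real^'n \<Rightarrow> real^'n^'n" where
  "hessian f x = jacobian (gradient f) (at x)"

definition C1 :: "(real^'n \<Rightarrow> real) \<Rightarrow> bool" where
  "C1 f \<longleftrightarrow> (\<forall>x. f differentiable (at x)) \<and> continuous_on UNIV (gradient f)"

definition C2 :: "(real^'n \<Rightarrow> real) \<Rightarrow> bool" where
  "C2 f \<longleftrightarrow> C1 f \<and> (\<forall>x. gradient f differentiable (at x)) \<and> continuous_on UNIV (hessian f)"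

text \<open>Symmetry is not part of this definition. It is only applied to Hessians of \<open>C2\<close> functions,
  which are symmetric anyway.\<close>

definition positive_definite :: "real^'n^'n \<Rightarrow> bool" where
  "positive_definite M \<longleftrightarrow> (\<forall>v. v \<noteq> 0 \<longrightarrow> v \<bullet> (M *v v) > 0)"

definition spectral_norm :: "real^'n^'m \<Rightarrow> real" where
  "spectral_norm M = onorm ((*v) M)"

text \<open>The rank of the submatrix \<open>A\<^sub>J\<close> is the dimension of its row space. Comparing it with
  \<open>card J\<close> rather than with the number of distinct rows excludes repeated rows.\<close>

definition full_row_rank_on :: "'m set \<Rightarrow> real^'n^'m \<Rightarrow> bool" where
  "full_row_rank_on J A \<longleftrightarrow> dim ((\<lambda>i. row i A) ` J) = card J"

text \<open>The size of \<open>H(J)\<close> depends on \<open>J\<close>, so square matrices of varying size are given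
  by an entry function \<open>M\<close> together with a finite index set \<open>K\<close>; entries outside
  \<open>K \<times> K\<close> are ignored. The singular values are the nonnegative square roots
  of the eigenvalues of \<open>M\<^sup>T M\<close>.\<close>

definition singular_values :: "'k set \<Rightarrow> ('k \<Rightarrow> 'k \<Rightarrow> real) \<Rightarrow> real set" where
  "singular_values K M = {\<sigma>. 0 \<le> \<sigma> \<and>
     (\<exists>v. (\<exists>k\<in>K. v k \<noteq> 0) \<and>
          (\<forall>i\<in>K. (\<Sum>j\<in>K. (\<Sum>l\<in>K. M l i * M l j) * v j) = \<sigma>\<^sup>2 * v i))}"

definition sigma_min :: "'k set \<Rightarrow> ('k \<Rightarrow> 'k \<Rightarrow> real) \<Rightarrow> real" where
  "sigma_min K M = Min (singular_values K M)"

text \<open>\<open>H(J)\<close> is the principal submatrix of \<open>block_matrix Q A\<close> on the index set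
  \<open>UNIV <+> J\<close>, where \<open>Q\<close> is the Hessian.\<close>

fun block_matrix :: "real^'n^'n \<Rightarrow> real^'n^'m \<Rightarrow> 'n + 'm \<Rightarrow> 'n + 'm \<Rightarrow> real" where
  "block_matrix Q A (Inl i) (Inl j) = Q $ i $ j"
| "block_matrix Q A (Inl i) (Inr j) = A $ j $ i"
| "block_matrix Q A (Inr i) (Inl j) = A $ i $ j"
| "block_matrix Q A (Inr i) (Inr j) = 0"

definition sigma_min_H ::
  "(real^'n \<Rightarrow> real) \<Rightarrow> real^'n^'m \<Rightarrow> real^'n \<Rightarrow> 'm set \<Rightarrow> real" where
  "sigma_min_H f A x J = sigma_min (UNIV <+> J) (block_matrix (hessian f x) A)"

definition pos_part :: "real^'m \<Rightarrow> real^'m" where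
  "pos_part u = (\<chi> i. max 0 (u $ i))"

definition norm0 :: "real^'m \<Rightarrow> nat" where
  "norm0 u = card {i. u $ i \<noteq> 0}"

definition sth_largest :: "nat \<Rightarrow> real^'m \<Rightarrow> real" where
  "sth_largest s u =
     (if norm0 (pos_part u) < s then 0
      else rev (sorted_list_of_multiset (image_mset (($) (pos_part u)) (mset_set UNIV))) ! (s - 1))"

definition S_set :: "nat \<Rightarrow> (real^'m) set" where
  "S_set s = {u. norm0 (pos_part u) \<le> s}"

definition proj_S :: "nat \<Rightarrow> real^'m \<Rightarrow> (real^'m) set" where
  "proj_S s z = {u. is_arg_min (\<lambda>u. norm (z - u)) (\<lambda>u. u \<in> S_set s) u}"

definition tau_stationary ::
  "(real^'n \<Rightarrow> real) \<Rightarrow> real^'n^'m \<Rightarrow> real^'m \<Rightarrow> nat \<Rightarrow> real \<Rightarrow> (real^'n) \<times> (real^'m) \<Rightarrow> bool" where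
  "tau_stationary f A b s \<tau> = (\<lambda>(x, l).
     gradient f x + transpose A *v l = 0 \<and>
     A *v x - b \<in> proj_S s (A *v x - b + \<tau> *\<^sub>R l))"

definition tau_star :: "real^'n^'m \<Rightarrow> real^'m \<Rightarrow> nat \<Rightarrow> (real^'n) \<times> (real^'m) \<Rightarrow> ereal" where
  "tau_star A b s = (\<lambda>(x, l).
     if l = 0 then \<infinity> else ereal (sth_largest s (A *v x - b) / Max (range (($) l))))"

definition zero_set :: "real^'n^'m \<Rightarrow> real^'m \<Rightarrow> real^'n \<Rightarrow> 'm set" where
  "zero_set A b x = {i. (A *v x - b) $ i = 0}"

definition c_star :: "(real^'n \<Rightarrow> real) \<Rightarrow> real^'n^'m \<Rightarrow> real^'m \<Rightarrow> real^'n \<Rightarrow> real" where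
  "c_star f A b x = 2 / min (Min (sigma_min_H f A x ` Pow (zero_set A b x))) 1"

definition T_sets :: "real^'m \<Rightarrow> nat \<Rightarrow> 'm set set" where
  "T_sets z s = {T. \<exists>G \<subseteq> {i. z $ i > 0}.
     card G = min s (card {i. z $ i > 0}) \<and>
     T = ({i. z $ i > 0} - G) \<union> {i. z $ i = 0} \<and>
     (\<forall>i\<in>G. \<forall>j\<in>T. z $ i \<ge> z $ j \<and> z $ j \<ge> 0)}"

definition newton_system ::
  "(real^'n \<Rightarrow> real) \<Rightarrow> real^'n^'m \<Rightarrow> real^'m \<Rightarrow> 'm set \<Rightarrow>
   (real^'n) \<times> (real^'m) \<Rightarrow> (real^'n) \<times> (real^'m) \<Rightarrow> bool" where
  "newton_system f A b T = (\<lambda>(x, l) (u, v).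
     hessian f x *v u + (\<Sum>i\<in>T. v $ i *\<^sub>R row i A) = - (gradient f x + (\<Sum>i\<in>T. l $ i *\<^sub>R row i A)) \<and>
     (\<forall>i\<in>T. (A *v u) $ i = - ((A *v x) $ i - b $ i)) \<and>
     (\<forall>i\<in>- T. v $ i = - (l $ i)))"

text \<open>The direction is a definite description, so a run can always be continued and is meaningful
  exactly as long as the systems are uniquely solvable. Being a run does not presuppose that
  the directions are well defined.\<close>

definition NHS_run ::
  "(real^'n \<Rightarrow> real) \<Rightarrow> real^'n^'m \<Rightarrow> real^'m \<Rightarrow> nat \<Rightarrow> real \<Rightarrow>
   (nat \<Rightarrow> (real^'n) \<times> (real^'m)) \<Rightarrow> (nat \<Rightarrow> 'm set) \<Rightarrow> (nat \<Rightarrow> (real^'n) \<times> (real^'m)) \<Rightarrow> bool" where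
  "NHS_run f A b s \<tau> w T d \<longleftrightarrow>
     (\<forall>k. T k \<in> T_sets (A *v fst (w k) - b + \<tau> *\<^sub>R snd (w k)) s \<and>
          d k = (THE e. newton_system f A b (T k) (w k) e) \<and>
          w (Suc k) = w k + d k)"

end

theory Submission
  imports Defs
begin

text \<open>
  Write the optimality system for a guess \<open>T\<close> of the active rows as \<open>F\<^sub>T(w) = 0\<close>, where \<open>F\<^sub>T\<close>
  stacks \<open>\<nabla>f(x) + A\<^sub>T\<^sup>T\<lambda>\<^sub>T\<close>, \<open>A\<^sub>T x - b\<^sub>T\<close> and \<open>\<lambda>\<close> off \<open>T\<close>. The step of the method is the Newton step for
  \<open>F\<^sub>T\<close>. The set \<open>T\<close> may change in every iteration, but near \<open>w\<^sup>*\<close> every admissible \<open>T\<close>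
  satisfies \<open>T \<subseteq> J\<^sub>*\<close> and contains the support of \<open>\<lambda>\<^sup>*\<close>, so that \<open>w\<^sup>*\<close> is a common zero of all the
  systems that occur (\<open>eventually_T_sets_active\<close>). It is therefore enough to analyse one Newton step, with
  constants that are uniform over \<open>T \<subseteq> J\<^sub>*\<close>.

  Identification of \<open>T\<close>: minimality of \<open>y\<^sup>* = Ax\<^sup>* - b\<close> forces \<open>\<lambda>\<^sup>* \<ge> 0\<close>, \<open>\<lambda>\<^sup>* = 0\<close> off \<open>J\<^sub>*\<close>, and
  \<open>\<lambda>\<^sup>* = 0\<close> altogether unless \<open>y\<^sup>*\<close> has exactly \<open>s\<close> positive entries (\<open>proj_S_multiplier\<close>). The bound
  \<open>\<tau> < \<tau>\<^sub>*\<close> says that each \<open>\<tau>\<lambda>\<^sup>*\<^sub>i\<close> lies strictly below each positive \<open>y\<^sup>*\<^sub>j\<close> (\<open>tau_star_gap\<close>). In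
  \<open>z\<^sup>* = y\<^sup>* + \<tau>\<lambda>\<^sup>*\<close> the positive entries of \<open>y\<^sup>*\<close> are thus strictly the largest ones, which survives a
  small perturbation of \<open>z\<^sup>*\<close>; hence they are among the \<open>s\<close> indices that are removed from \<open>T\<close>.

  Constants: the Newton matrix is \<open>H(T)\<close> plus an identity block, so at \<open>x\<^sup>*\<close> it expands norms by
  at least \<open>min {\<sigma>\<^sub>m\<^sub>i\<^sub>n(H(T)), 1} \<ge> 2/c\<^sub>*\<close> (\<open>norm_newton_operator_ge_c_star\<close>). Inside the ball of radius
  \<open>1/(c\<^sub>*L\<^sub>*)\<close> the Hessian moves by at most \<open>1/c\<^sub>*\<close>, which leaves the factor \<open>1/c\<^sub>*\<close>. This gives unique
  solvability. As \<open>A\<close> enters linearly, the Newton matrix maps the new error to the first-order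
  Taylor remainder of \<open>\<nabla>f\<close> alone (\<open>newton_operator_error\<close>), whose norm is at most
  \<open>L\<^sub>*/2 \<parallel>x - x\<^sup>*\<parallel>\<^sup>2\<close>. Dividing by \<open>1/c\<^sub>*\<close> yields the factor \<open>c\<^sub>*L\<^sub>*/2\<close>. In the ball of radius
  \<open>1/(c\<^sub>*L\<^sub>*)\<close> this at least halves the error, so the iteration stays in the ball and converges.

  That \<open>\<sigma>\<^sub>m\<^sub>i\<^sub>n\<close>, the least square root of an eigenvalue of \<open>M\<^sup>TM\<close>, bounds \<open>\<parallel>Mv\<parallel>/\<parallel>v\<parallel>\<close> from below
  is shown variationally: the minimum of this quotient is attained, and a minimizer is an
  eigenvector (\<open>singular_value_lower_bound_exists\<close>).
\<close>

section \<open>Smallest singular values\<close>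

text \<open>Matrices on an index set \<open>K\<close> are padded with zeros to matrices over the whole index type, so that
  the Euclidean structure of \<open>real^'k\<close> becomes available.\<close>

definition cutoff_matrix :: "'k::finite set \<Rightarrow> ('k \<Rightarrow> 'k \<Rightarrow> real) \<Rightarrow> real^'k^'k" where
  "cutoff_matrix K M = (\<chi> i j. if i \<in> K \<and> j \<in> K then M i j else 0)"

definition supported_on :: "'k::finite set \<Rightarrow> (real^'k) set" where
  "supported_on K = {v. \<forall>i. i \<notin> K \<longrightarrow> v $ i = 0}"

lemma gram_cutoff_matrix_nth:
  fixes v :: "real^'k::finite"
  shows "((transpose (cutoff_matrix K M) ** cutoff_matrix K M) *v v) $ i =
    (if i \<in> K then (\<Sum>j\<in>K. (\<Sum>l\<in>K. M l i * M l j) * v $ j) else 0)"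
proof -
  have entry: "(transpose (cutoff_matrix K M) ** cutoff_matrix K M) $ i $ j =
      (if i \<in> K \<and> j \<in> K then (\<Sum>l\<in>K. M l i * M l j) else 0)" for j
  proof (cases "i \<in> K \<and> j \<in> K")
    case True
    then show ?thesis
      by (auto simp: matrix_matrix_mult_def transpose_def cutoff_matrix_def intro!: sum.mono_neutral_cong_right)
  next
    case False
    then show ?thesis
      by (auto simp: matrix_matrix_mult_def transpose_def cutoff_matrix_def)
  qed
  show ?thesis
    by (auto simp: matrix_vector_mult_def entry if_distrib[where f="\<lambda>x. x * _"] intro!: sum.mono_neutral_cong_right)
qed

lemma inner_gram:
  fixes N :: "real^'k^'l::finite"
  shows "((transpose N ** N) *v v) \<bullet> w = (N *v v) \<bullet> (N *v w)"
  by (metis dot_lmul_matrix matrix_vector_mul_assoc vector_transpose_matrix inner_commute transpose_matrix_vector)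

lemma mem_singular_values_iff:
  fixes K :: "'k::finite set"
  shows "\<sigma> \<in> singular_values K M \<longleftrightarrow> 0 \<le> \<sigma> \<and>
    (\<exists>v\<in>supported_on K. v \<noteq> 0 \<and>
       (transpose (cutoff_matrix K M) ** cutoff_matrix K M) *v v = \<sigma>\<^sup>2 *\<^sub>R v)"
    (is "_ \<longleftrightarrow> _ \<and> ?R")
proof -
  let ?P = "\<lambda>v. (\<exists>k\<in>K. v k \<noteq> 0) \<and>
     (\<forall>i\<in>K. (\<Sum>j\<in>K. (\<Sum>l\<in>K. M l i * M l j) * v j) = \<sigma>\<^sup>2 * v i)"
  have "(\<exists>v. ?P v) \<longleftrightarrow> ?R"
  proof
    assume "\<exists>v. ?P v"
    then obtain v where v: "?P v" by blast
    let ?v = "\<chi> i. if i \<in> K then v i else 0"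
    have "?v \<in> supported_on K" "?v \<noteq> 0"
      using v by (auto simp: supported_on_def vec_eq_iff)
    moreover have "(transpose (cutoff_matrix K M) ** cutoff_matrix K M) *v ?v = \<sigma>\<^sup>2 *\<^sub>R ?v"
      using v by (simp add: vec_eq_iff gram_cutoff_matrix_nth)
    ultimately show ?R by blast
  next
    assume ?R
    then obtain v where v: "v \<in> supported_on K" "v \<noteq> 0"
      "(transpose (cutoff_matrix K M) ** cutoff_matrix K M) *v v = \<sigma>\<^sup>2 *\<^sub>R v" by blast
    have "?P (($) v)"
    proof
      show "\<exists>k\<in>K. v $ k \<noteq> 0" using v(1,2) by (auto simp: supported_on_def vec_eq_iff)
      have "((transpose (cutoff_matrix K M) ** cutoff_matrix K M) *v v) $ i = \<sigma>\<^sup>2 * v $ i" for i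
        using v(3) by simp
      then show "\<forall>i\<in>K. (\<Sum>j\<in>K. (\<Sum>l\<in>K. M l i * M l j) * v $ j) = \<sigma>\<^sup>2 * v $ i"
        unfolding gram_cutoff_matrix_nth by metis
    qed
    then show "\<exists>v. ?P v" by blast
  qed
  then show ?thesis by (simp add: singular_values_def)
qed

text \<open>\<open>Min\<close> is meaningful only on finite sets. Finiteness holds because eigenvectors of the symmetric
  matrix \<open>M\<^sup>TM\<close> for different eigenvalues are orthogonal, hence linearly independent.\<close>

lemma finite_singular_values:
  fixes K :: "'k::finite set"
  shows "finite (singular_values K M)"
proof -
  let ?G = "transpose (cutoff_matrix K M) ** cutoff_matrix K M"
  have "\<forall>\<sigma>\<in>singular_values K M. \<exists>v. v \<noteq> 0 \<and> ?G *v v = \<sigma>\<^sup>2 *\<^sub>R v"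
    by (auto simp: mem_singular_values_iff)
  then obtain v where v: "\<And>\<sigma>. \<sigma> \<in> singular_values K M \<Longrightarrow> v \<sigma> \<noteq> 0"
    "\<And>\<sigma>. \<sigma> \<in> singular_values K M \<Longrightarrow> ?G *v v \<sigma> = \<sigma>\<^sup>2 *\<^sub>R v \<sigma>" by metis
  have orth: "v \<sigma> \<bullet> v \<rho> = 0" if "\<sigma> \<in> singular_values K M" "\<rho> \<in> singular_values K M" "\<sigma> \<noteq> \<rho>" for \<sigma> \<rho>
  proof -
    have "\<sigma>\<^sup>2 * (v \<sigma> \<bullet> v \<rho>) = (?G *v v \<sigma>) \<bullet> v \<rho>" using v(2)[OF that(1)] by simp
    also have "\<dots> = (?G *v v \<rho>) \<bullet> v \<sigma>" by (metis inner_gram inner_commute)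
    also have "\<dots> = \<rho>\<^sup>2 * (v \<sigma> \<bullet> v \<rho>)" using v(2)[OF that(2)] by (simp add: inner_commute)
    finally have "(\<sigma>\<^sup>2 - \<rho>\<^sup>2) * (v \<sigma> \<bullet> v \<rho>) = 0" by (simp add: algebra_simps)
    moreover have "\<sigma>\<^sup>2 \<noteq> \<rho>\<^sup>2"
      using that by (simp add: singular_values_def)
    ultimately show ?thesis by simp
  qed
  have inj: "inj_on v (singular_values K M)"
    by (rule inj_onI) (metis orth v(1) inner_eq_zero_iff)
  have "independent (v ` singular_values K M)"
    using orth v(1) by (intro pairwise_orthogonal_independent) (auto simp: pairwise_def orthogonal_def)
  then have "finite (v ` singular_values K M)"
    using independent_bound by blast
  with inj show ?thesis by (simp add: finite_image_iff)
qed

text \<open>A quadratic without constant term that never becomes negative has its minimum at \<open>0\<close>. The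
  contradiction comes from the value at \<open>t = -B/(q + 1)\<close>; adding \<open>1\<close> to \<open>q\<close> covers the case
  \<open>q = 0\<close>.\<close>

lemma linear_coefficient_zero:
  fixes B q :: real
  assumes "q \<ge> 0" and nonneg: "\<And>t. 0 \<le> 2 * t * B + t\<^sup>2 * q"
  shows "B = 0"
proof (rule ccontr)
  assume "B \<noteq> 0"
  have "0 \<le> 2 * (- B / (q + 1)) * B + (- B / (q + 1))\<^sup>2 * q" by (rule nonneg)
  also have "\<dots> = - (B\<^sup>2 * (q + 2)) / (q + 1)\<^sup>2"
  proof -
    have "q + 1 \<noteq> 0" using assms(1) by simp
    then show ?thesis by (simp add: divide_simps power2_eq_square) (simp add: algebra_simps)
  qed
  also have "\<dots> < 0" using assms(1) \<open>B \<noteq> 0\<close> by (simp add: divide_less_0_iff)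
  finally show False by simp
qed

text \<open>Let \<open>v\<close> minimize \<open>\<parallel>Nv\<parallel>\<close> on the unit sphere, with minimum \<open>\<sigma>\<close>. The quadratic form
  \<open>\<parallel>Nw\<parallel>\<^sup>2 - \<sigma>\<^sup>2\<parallel>w\<parallel>\<^sup>2\<close> is nonnegative and vanishes at \<open>v\<close>, so its derivative vanishes there. This says
  that \<open>N\<^sup>TNv = \<sigma>\<^sup>2v\<close>.\<close>

lemma singular_value_lower_bound_exists:
  fixes K :: "'k::finite set"
  assumes "K \<noteq> {}"
  shows "\<exists>\<sigma>\<in>singular_values K M. \<forall>v\<in>supported_on K. \<sigma> * norm v \<le> norm (cutoff_matrix K M *v v)"
proof -
  let ?N = "cutoff_matrix K M"
  let ?S = "sphere 0 1 \<inter> supported_on K"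
  have sub: "subspace (supported_on K)"
    by (auto simp: subspace_def supported_on_def)
  have "compact ?S"
    by (simp add: closed_subspace compact_Int_closed sub)
  moreover obtain k where k: "k \<in> K" using assms by blast
  then have "axis k 1 \<in> ?S" by (auto simp: supported_on_def axis_def norm_axis_1[unfolded axis_def])
  then have "?S \<noteq> {}" by blast
  moreover have "continuous_on ?S (\<lambda>v. norm (?N *v v))"
    by (intro continuous_intros linear_continuous_on matrix_vector_mul_bounded_linear)
  ultimately obtain v where v: "v \<in> ?S" "\<And>w. w \<in> ?S \<Longrightarrow> norm (?N *v v) \<le> norm (?N *v w)"
    using continuous_attains_inf by meson
  define \<sigma> where "\<sigma> = norm (?N *v v)"
  have bound: "\<sigma> * norm w \<le> norm (?N *v w)" if "w \<in> supported_on K" for w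
  proof (cases "w = 0")
    case False
    have "inverse (norm w) *\<^sub>R w \<in> ?S"
      using False that sub by (simp add: subspace_scale)
    from v(2)[OF this] have "\<sigma> \<le> inverse (norm w) * norm (?N *v w)"
      by (simp add: \<sigma>_def matrix_vector_mult_scaleR)
    then show ?thesis using False by (simp add: field_simps)
  qed simp
  define q where "q w = norm (?N *v w) ^ 2 - \<sigma>\<^sup>2 * norm w ^ 2" for w
  have q_nonneg: "q w \<ge> 0" if "w \<in> supported_on K" for w
    using power_mono[OF bound[OF that], of 2] by (simp add: q_def \<sigma>_def power_mult_distrib)
  have crit: "(?N *v v) \<bullet> (?N *v h) - \<sigma>\<^sup>2 * (v \<bullet> h) = 0" (is "?B = 0") if "h \<in> supported_on K" for h
  proof (rule linear_coefficient_zero)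
    show "q h \<ge> 0" using q_nonneg that .
    show "0 \<le> 2 * t * ?B + t\<^sup>2 * q h" for t
    proof -
      have "v + t *\<^sub>R h \<in> supported_on K" using that v(1) sub by (simp add: subspace_add subspace_scale)
      then have "0 \<le> q (v + t *\<^sub>R h)" by (rule q_nonneg)
      also have "\<dots> = 2 * t * ?B + t\<^sup>2 * q h"
        using v(1) unfolding q_def \<sigma>_def power2_norm_eq_inner
        by (simp add: matrix_vector_right_distrib matrix_vector_mult_scaleR inner_add_left inner_add_right
            inner_commute power2_eq_square algebra_simps norm_eq_1)
      finally show ?thesis .
    qed
  qed
  have "(transpose ?N ** ?N) *v v = \<sigma>\<^sup>2 *\<^sub>R v"
  proof (rule vec_eq_iff[THEN iffD2], rule allI)
    fix i
    show "((transpose ?N ** ?N) *v v) $ i = (\<sigma>\<^sup>2 *\<^sub>R v) $ i"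
    proof (cases "i \<in> K")
      case True
      then have "axis i 1 \<in> supported_on K" by (auto simp: supported_on_def axis_def)
      from crit[OF this] show ?thesis
        by (simp flip: inner_gram add: inner_axis)
    next
      case False
      then show ?thesis using v(1) by (simp add: gram_cutoff_matrix_nth supported_on_def)
    qed
  qed
  then have "\<sigma> \<in> singular_values K M"
    using v(1) unfolding mem_singular_values_iff
    by (intro conjI bexI[of _ v]) (auto simp: \<sigma>_def)
  with bound show ?thesis by blast
qed

lemma sigma_min_mult_norm_le:
  fixes K :: "'k::finite set"
  assumes "K \<noteq> {}" "v \<in> supported_on K"
  shows "sigma_min K M * norm v \<le> norm (cutoff_matrix K M *v v)"
proof -
  obtain \<sigma> where \<sigma>: "\<sigma> \<in> singular_values K M" "\<sigma> * norm v \<le> norm (cutoff_matrix K M *v v)"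
    using singular_value_lower_bound_exists[OF assms(1)] assms(2) by blast
  have "sigma_min K M \<le> \<sigma>"
    unfolding sigma_min_def using finite_singular_values \<sigma>(1) by (rule Min_le)
  then show ?thesis using \<sigma>(2) by (meson mult_right_mono norm_ge_zero order_trans)
qed

lemma sigma_min_pos:
  fixes K :: "'k::finite set"
  assumes "K \<noteq> {}" and inj: "\<And>v. v \<in> supported_on K \<Longrightarrow> cutoff_matrix K M *v v = 0 \<Longrightarrow> v = 0"
  shows "sigma_min K M > 0"
proof -
  have "singular_values K M \<noteq> {}"
    using singular_value_lower_bound_exists[OF assms(1)] by blast
  then have "sigma_min K M \<in> singular_values K M"
    unfolding sigma_min_def using finite_singular_values by (rule Min_in[rotated])
  then obtain v where v: "0 \<le> sigma_min K M" "v \<in> supported_on K" "v \<noteq> 0"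
    "(transpose (cutoff_matrix K M) ** cutoff_matrix K M) *v v = (sigma_min K M)\<^sup>2 *\<^sub>R v"
    unfolding mem_singular_values_iff by blast
  have "sigma_min K M \<noteq> 0"
  proof
    assume "sigma_min K M = 0"
    with v(4) have "(cutoff_matrix K M *v v) \<bullet> (cutoff_matrix K M *v v) = 0"
      by (simp flip: inner_gram)
    with inj[OF v(2)] v(3) show False by simp
  qed
  with v(1) show ?thesis by simp
qed

section \<open>The Newton operator and saddle point matrices\<close>

text \<open>The matrix of the Newton system, with the equations put back into the original order of the rows.
  The index set \<open>T\<close> then no longer affects the type, and the operators for different \<open>T\<close>
  act on one Euclidean space.\<close>

definition newton_operator ::
  "real^'n^'n \<Rightarrow> real^'n^'m \<Rightarrow> 'm set \<Rightarrow> (real^'n) \<times> (real^'m) \<Rightarrow> (real^'n) \<times> (real^'m)" where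
  "newton_operator Q A T = (\<lambda>(u, v).
     (Q *v u + (\<Sum>i\<in>T. v $ i *\<^sub>R row i A), \<chi> i. if i \<in> T then (A *v u) $ i else v $ i))"

lemma linear_newton_operator: "linear (newton_operator Q A T)"
  by (rule linearI)
    (auto simp: newton_operator_def vec_eq_iff matrix_vector_right_distrib matrix_vector_mult_scaleR
      scaleR_left_distrib sum.distrib scaleR_right.sum scaleR_right_distrib)

text \<open>The pair \<open>(u, v\<^sub>T)\<close> as a vector indexed like the rows of \<open>H(T)\<close>.\<close>

definition kkt_vector :: "'m set \<Rightarrow> real^'n \<Rightarrow> real^'m \<Rightarrow> real^('n + 'm)" where
  "kkt_vector T u v = (\<chi> k. case k of Inl i \<Rightarrow> u $ i | Inr j \<Rightarrow> if j \<in> T then v $ j else 0)"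

lemma kkt_vector_nth [simp]:
  "kkt_vector T u v $ Inl i = u $ i"
  "kkt_vector T u v $ Inr j = (if j \<in> T then v $ j else 0)"
  by (simp_all add: kkt_vector_def)

lemma supported_on_kkt_vector: "kkt_vector T (u :: real^'a) (v :: real^'b) \<in> supported_on (UNIV <+> T)"
  unfolding supported_on_def
proof (intro CollectI allI impI)
  fix k :: "'a + 'b" assume "k \<notin> UNIV <+> T" then show "kkt_vector T u v $ k = 0" by (cases k) auto
qed

lemma power2_norm_vec: "(norm (v :: real^'k::finite))\<^sup>2 = (\<Sum>i\<in>UNIV. (v $ i)\<^sup>2)"
  by (simp add: power2_norm_eq_inner inner_vec_def power2_eq_square[of "_ $ _"])

lemma power2_norm_Pair: "(norm (a, b))\<^sup>2 = (norm a)\<^sup>2 + (norm b)\<^sup>2"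
  by (simp add: norm_Pair)

lemma power2_norm_kkt_vector:
  "(norm (kkt_vector T u v))\<^sup>2 = (norm u)\<^sup>2 + (\<Sum>j\<in>T. (v $ j)\<^sup>2)"
proof -
  have "(norm (kkt_vector T u v))\<^sup>2 = (\<Sum>k\<in>UNIV <+> UNIV. (kkt_vector T u v $ k)\<^sup>2)"
    unfolding power2_norm_vec by simp
  also have "\<dots> = (\<Sum>i\<in>UNIV. (u $ i)\<^sup>2) + (\<Sum>j\<in>UNIV. (if j \<in> T then v $ j else 0)\<^sup>2)"
    by (subst sum.Plus) auto
  also have "(\<Sum>j\<in>UNIV. (if j \<in> T then v $ j else 0)\<^sup>2) = (\<Sum>j\<in>T. (v $ j)\<^sup>2)"
    by (rule sum.mono_neutral_cong_right) auto
  finally show ?thesis by (simp add: power2_norm_vec)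
qed

lemma block_matrix_mult_kkt_vector:
  "cutoff_matrix (UNIV <+> T) (block_matrix Q A) *v kkt_vector T u v =
   kkt_vector T (Q *v u + (\<Sum>i\<in>T. v $ i *\<^sub>R row i A)) (A *v u)"
proof (rule vec_eq_iff[THEN iffD2], rule allI)
  fix k :: "'a + 'b"
  have mem: "Inl i \<in> UNIV <+> T" "Inr j \<in> (UNIV :: 'a set) <+> T \<longleftrightarrow> j \<in> T" for i :: 'a and j by auto
  let ?M = "block_matrix Q A"
  have "(cutoff_matrix (UNIV <+> T) ?M *v kkt_vector T u v) $ k =
      (\<Sum>l\<in>UNIV <+> UNIV. (if k \<in> UNIV <+> T \<and> l \<in> UNIV <+> T then ?M k l else 0) * kkt_vector T u v $ l)"
    by (simp add: matrix_vector_mult_def cutoff_matrix_def)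
  also have "\<dots> = (\<Sum>i\<in>UNIV. (if k \<in> UNIV <+> T then ?M k (Inl i) else 0) * u $ i) +
      (\<Sum>j\<in>UNIV. (if k \<in> UNIV <+> T \<and> j \<in> T then ?M k (Inr j) else 0) * (if j \<in> T then v $ j else 0))"
    by (subst sum.Plus) (auto simp: Plus_def image_iff)
  also have "(\<Sum>j\<in>UNIV. (if k \<in> UNIV <+> T \<and> j \<in> T then ?M k (Inr j) else 0) * (if j \<in> T then v $ j else 0)) =
      (\<Sum>j\<in>T. (if k \<in> UNIV <+> T then ?M k (Inr j) else 0) * v $ j)"
    by (rule sum.mono_neutral_cong_right) auto
  finally show "(cutoff_matrix (UNIV <+> T) ?M *v kkt_vector T u v) $ k =
      kkt_vector T (Q *v u + (\<Sum>i\<in>T. v $ i *\<^sub>R row i A)) (A *v u) $ k"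
    by (cases k) (auto simp: mem matrix_vector_mult_def row_def mult.commute)
qed

text \<open>The Newton operator is the orthogonal sum of \<open>H(T)\<close> and the identity on the entries outside
  \<open>T\<close>.\<close>

lemma power2_norm_newton_operator:
  "(norm (newton_operator Q A T (u, v)))\<^sup>2 =
   (norm (cutoff_matrix (UNIV <+> T) (block_matrix Q A) *v kkt_vector T u v))\<^sup>2 + (\<Sum>j\<in>- T. (v $ j)\<^sup>2)"
proof -
  have "(\<Sum>j\<in>UNIV. (if j \<in> T then (A *v u) $ j else v $ j)\<^sup>2) =
      (\<Sum>j\<in>T \<union> - T. (if j \<in> T then (A *v u) $ j else v $ j)\<^sup>2)"
    by simp
  also have "\<dots> = (\<Sum>j\<in>T. ((A *v u) $ j)\<^sup>2) + (\<Sum>j\<in>- T. (v $ j)\<^sup>2)"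
    by (subst sum.union_disjoint) auto
  finally show ?thesis
    by (simp add: newton_operator_def power2_norm_Pair power2_norm_vec[of "\<chi> i. _ i"]
        block_matrix_mult_kkt_vector power2_norm_kkt_vector)
qed

lemma norm_newton_operator_ge:
  assumes "0 \<le> \<mu>" "\<mu> \<le> 1" "\<mu> \<le> sigma_min (UNIV <+> T) (block_matrix Q A)"
  shows "\<mu> * norm e \<le> norm (newton_operator Q A T e)"
proof -
  obtain u v where e: "e = (u, v)" by (cases e)
  let ?k = "kkt_vector T u v" and ?N = "cutoff_matrix (UNIV <+> T) (block_matrix Q A)"
  have ne: "(UNIV <+> T :: ('a + 'b) set) \<noteq> {}" by auto
  have "\<mu> * norm ?k \<le> sigma_min (UNIV <+> T) (block_matrix Q A) * norm ?k"
    using assms(3) by (rule mult_right_mono) simp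
  also have "\<dots> \<le> norm (?N *v ?k)"
    by (rule sigma_min_mult_norm_le[OF ne supported_on_kkt_vector])
  finally have "(\<mu> * norm ?k)\<^sup>2 \<le> (norm (?N *v ?k))\<^sup>2"
    using assms(1) by (intro power_mono) auto
  moreover have "\<mu>\<^sup>2 * (\<Sum>j\<in>- T. (v $ j)\<^sup>2) \<le> 1 * (\<Sum>j\<in>- T. (v $ j)\<^sup>2)"
    using assms(1,2) by (intro mult_right_mono) (auto intro: sum_nonneg simp: power_le_one)
  moreover have "(norm e)\<^sup>2 = (norm ?k)\<^sup>2 + (\<Sum>j\<in>- T. (v $ j)\<^sup>2)"
  proof -
    have "(norm v)\<^sup>2 = (\<Sum>j\<in>T \<union> - T. (v $ j)\<^sup>2)" by (simp add: power2_norm_vec)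
    also have "\<dots> = (\<Sum>j\<in>T. (v $ j)\<^sup>2) + (\<Sum>j\<in>- T. (v $ j)\<^sup>2)" by (rule sum.union_disjoint) auto
    finally show ?thesis by (simp add: e power2_norm_Pair power2_norm_kkt_vector)
  qed
  ultimately have "(\<mu> * norm e)\<^sup>2 \<le> (norm (newton_operator Q A T e))\<^sup>2"
    by (simp add: e power2_norm_newton_operator power_mult_distrib algebra_simps)
  then show ?thesis by (rule power2_le_imp_le) simp
qed

text \<open>A family of \<open>card J\<close> vectors whose span has dimension \<open>card J\<close> consists of distinct vectors and is
  linearly independent.\<close>

lemma full_row_rank_onD:
  assumes rank: "full_row_rank_on J A" and "T \<subseteq> J"
    and zero: "(\<Sum>i\<in>T. c i *\<^sub>R row i A) = 0" and "i \<in> T"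
  shows "c i = 0"
proof -
  let ?r = "\<lambda>i. row i A"
  have "card J \<le> card (?r ` J)"
    using rank unfolding full_row_rank_on_def by (metis dim_le_card' finite finite_imageI)
  then have card: "card (?r ` J) = card J" by (simp add: card_image_le le_antisym)
  then have inj: "inj_on ?r J" by (simp add: eq_card_imp_inj_on)
  have ind: "independent (?r ` J)"
    by (rule card_le_dim_spanning[of _ "?r ` J"])
      (use rank card in \<open>auto simp: full_row_rank_on_def span_base\<close>)
  have inj_T: "inj_on ?r T" using inj \<open>T \<subseteq> J\<close> by (rule inj_on_subset)
  let ?u = "\<lambda>x. c (inv_into T ?r x)"
  have inv: "?u (row k A) = c k" if "k \<in> T" for k
    using inv_into_f_f[OF inj_T that] by simp
  have "(\<Sum>x\<in>?r ` T. ?u x *\<^sub>R x) = 0"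
    using zero inv by (simp add: sum.reindex[OF inj_T] cong: sum.cong)
  then have "?u (?r i) = 0"
    by (rule independentD[OF ind, rotated 2]) (use \<open>i \<in> T\<close> \<open>T \<subseteq> J\<close> in auto)
  then show ?thesis using inv[OF \<open>i \<in> T\<close>] by simp
qed

text \<open>The usual nonsingularity argument for saddle point matrices: if \<open>Qu + A\<^sub>T\<^sup>Tv = 0\<close> and \<open>A\<^sub>Tu = 0\<close>,
  multiplying the first equation by \<open>u\<close> leaves \<open>u\<^sup>TQu = 0\<close>. Thus \<open>u = 0\<close>, and then \<open>v = 0\<close> by
  independence of the rows.\<close>

lemma sigma_min_block_matrix_pos:
  assumes pd: "positive_definite Q" and rank: "full_row_rank_on J A" and "T \<subseteq> J"
  shows "0 < sigma_min (UNIV <+> T) (block_matrix Q A)"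
proof (rule sigma_min_pos)
  fix w :: "real^('a + 'b)"
  assume w: "w \<in> supported_on (UNIV <+> T)"
    and zero: "cutoff_matrix (UNIV <+> T) (block_matrix Q A) *v w = 0"
  define u v where "u = (\<chi> i. w $ Inl i)" and "v = (\<chi> j. w $ Inr j)"
  have wk: "w = kkt_vector T u v"
    unfolding vec_eq_iff
  proof
    fix k show "w $ k = kkt_vector T u v $ k"
      using w by (cases k) (auto simp: u_def v_def supported_on_def)
  qed
  let ?a = "Q *v u + (\<Sum>i\<in>T. v $ i *\<^sub>R row i A)"
  have k0: "kkt_vector T ?a (A *v u) = 0"
    using zero by (simp add: wk block_matrix_mult_kkt_vector)
  have a0: "?a = 0"
  proof (rule vec_eq_iff[THEN iffD2], rule allI)
    fix i show "?a $ i = 0 $ i"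
      using arg_cong[OF k0, of "\<lambda>x. x $ Inl i"] by simp
  qed
  have Au: "(A *v u) $ j = 0" if "j \<in> T" for j
    using arg_cong[OF k0, of "\<lambda>x. x $ Inr j"] that by simp
  have "row j A \<bullet> u = (A *v u) $ j" for j
    by (simp add: inner_vec_def matrix_vector_mult_def row_def)
  then have "u \<bullet> (\<Sum>i\<in>T. v $ i *\<^sub>R row i A) = 0"
    using Au by (simp add: inner_sum_right inner_commute)
  then have "u \<bullet> (Q *v u) = 0"
    using arg_cong[OF a0, of "\<lambda>x. u \<bullet> x"] by (simp add: inner_add_right)
  then have u0: "u = 0" using pd unfolding positive_definite_def by force
  then have "(\<Sum>i\<in>T. v $ i *\<^sub>R row i A) = 0" using a0 by simp
  then have "v $ j = 0" if "j \<in> T" for j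
    using full_row_rank_onD[OF rank \<open>T \<subseteq> J\<close>, where c="\<lambda>i. v $ i"] that by simp
  with u0 show "w = 0" using w unfolding wk vec_eq_iff
    by (metis kkt_vector_nth obj_sumE zero_index)
qed auto

section \<open>Stationary points and identification of the active set\<close>

lemma norm0_pos_part: "norm0 (pos_part u) = card {i. 0 < u $ i}"
  unfolding norm0_def pos_part_def by (rule arg_cong[of _ _ card]) auto

text \<open>Replacing \<open>y\<^sub>i\<close> by \<open>y\<^sub>i + r l\<^sub>i\<close> moves \<open>y\<close> towards the projected point \<open>y + \<tau>l\<close> when \<open>0 < r \<le> \<tau>\<close>. If the
  moved point is still feasible, minimality leaves only \<open>l\<^sub>i = 0\<close>. Each necessary condition below
  is an instance with a suitable \<open>r\<close>.\<close>

lemma proj_S_feasible_coordinate: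
  assumes opt: "y \<in> proj_S s (y + \<tau> *\<^sub>R l)" and "0 < r" "r \<le> \<tau>"
    and feas: "card {j. 0 < (y + (r * l $ i) *\<^sub>R axis i 1) $ j} \<le> s"
  shows "l $ i = 0"
proof -
  let ?u = "y + (r * l $ i) *\<^sub>R axis i 1"
  have "?u \<in> S_set s" using feas by (simp add: S_set_def norm0_pos_part)
  with opt have "norm (\<tau> *\<^sub>R l) \<le> norm (y + \<tau> *\<^sub>R l - ?u)"
    unfolding proj_S_def is_arg_min_def by force
  also have "y + \<tau> *\<^sub>R l - ?u = \<tau> *\<^sub>R l - (r * l $ i) *\<^sub>R axis i 1" by simp
  finally have "(norm (\<tau> *\<^sub>R l))\<^sup>2 \<le> (norm (\<tau> *\<^sub>R l - (r * l $ i) *\<^sub>R axis i 1))\<^sup>2"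
    by (intro power_mono) auto
  also have "\<dots> = (norm (\<tau> *\<^sub>R l))\<^sup>2 - r * (2 * \<tau> - r) * (l $ i)\<^sup>2"
    unfolding power2_norm_eq_inner
    by (simp add: inner_diff_left inner_diff_right inner_axis inner_axis' algebra_simps power2_eq_square)
  finally have "r * (2 * \<tau> - r) * (l $ i)\<^sup>2 \<le> 0" by simp
  moreover have "r * (2 * \<tau> - r) > 0" using assms(2,3) by simp
  ultimately show ?thesis by (metis mult_pos_pos not_less zero_less_power2)
qed

text \<open>A nonzero entry of \<open>y\<close> keeps its sign under a small move, a zero entry may always be made negative,
  and if fewer than \<open>s\<close> entries are positive then a single entry may be given any value.\<close>

lemma proj_S_multiplier:
  assumes opt: "y \<in> proj_S s (y + \<tau> *\<^sub>R l)" and "0 < \<tau>"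
  shows "card {i. 0 < y $ i} \<le> s"
    and "y $ i \<noteq> 0 \<Longrightarrow> l $ i = 0"
    and "0 \<le> l $ i"
    and "card {i. 0 < y $ i} < s \<Longrightarrow> l = 0"
proof -
  show card: "card {i. 0 < y $ i} \<le> s"
    using opt by (simp add: proj_S_def is_arg_min_def S_set_def norm0_pos_part)
  show off: "l $ i = 0" if "y $ i \<noteq> 0" for i
  proof -
    \<comment> \<open>The step is so short that \<open>y\<^sub>i\<close> keeps its sign; adding \<open>1\<close> avoids a division by zero.\<close>
    define r where "r = min \<tau> (\<bar>y $ i\<bar> / (\<bar>l $ i\<bar> + 1))"
    have r: "0 < r" "r \<le> \<tau>" using \<open>0 < \<tau>\<close> that by (auto simp: r_def)
    have "r * (\<bar>l $ i\<bar> + 1) \<le> \<bar>y $ i\<bar>"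
      by (auto simp: r_def simp flip: pos_le_divide_eq)
    then have "\<bar>r * l $ i\<bar> < \<bar>y $ i\<bar>" using r(1) by (simp add: abs_mult algebra_simps)
    then have sign: "0 < y $ i + r * l $ i \<longleftrightarrow> 0 < y $ i" by linarith
    have "{j. 0 < (y + (r * l $ i) *\<^sub>R axis i 1) $ j} = {j. 0 < y $ j}"
      using sign by (auto simp: axis_def split: if_splits)
    then show ?thesis using card r by (intro proj_S_feasible_coordinate[OF opt]) auto
  qed
  show nonneg: "0 \<le> l $ i" for i
  proof (rule ccontr)
    assume neg: "\<not> 0 \<le> l $ i"
    then have "y $ i = 0" using off by fastforce
    moreover have "\<tau> * l $ i < 0" using neg \<open>0 < \<tau>\<close> by (simp add: mult_pos_neg)
    ultimately have "{j. 0 < (y + (\<tau> * l $ i) *\<^sub>R axis i 1) $ j} = {j. 0 < y $ j}"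
      by (auto simp: axis_def split: if_splits)
    then have "l $ i = 0" using card \<open>0 < \<tau>\<close> by (intro proj_S_feasible_coordinate[OF opt]) auto
    with neg show False by simp
  qed
  show "l = 0" if less: "card {i. 0 < y $ i} < s"
  proof -
    have "l $ i = 0" for i
    proof -
      have "{j. 0 < (y + (\<tau> * l $ i) *\<^sub>R axis i 1) $ j} \<subseteq> insert i {j. 0 < y $ j}"
        by (auto simp: axis_def split: if_splits)
      then have "card {j. 0 < (y + (\<tau> * l $ i) *\<^sub>R axis i 1) $ j} \<le> card (insert i {j. 0 < y $ j})"
        by (intro card_mono) auto
      also have "\<dots> \<le> s" using less by (simp add: card_insert_if)
      finally show ?thesis using \<open>0 < \<tau>\<close> by (intro proj_S_feasible_coordinate[OF opt]) auto
    qed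
    then show ?thesis by (simp add: vec_eq_iff)
  qed
qed

text \<open>Otherwise the \<open>s\<close> leading entries of the sorted list all exceed \<open>y\<^sub>j\<close>, which makes \<open>s + 1\<close> positive
  entries together with \<open>y\<^sub>j\<close>.\<close>

lemma sth_largest_le_positive_entry:
  assumes card: "card {i. 0 < y $ i} = s" and "0 < s" and pos: "0 < y $ j"
  shows "sth_largest s y \<le> y $ j"
proof (rule ccontr)
  let ?M = "image_mset (($) (pos_part y)) (mset_set UNIV)"
  let ?xs = "rev (sorted_list_of_multiset ?M)"
  assume "\<not> ?thesis"
  then have gt: "y $ j < ?xs ! (s - 1)"
    using card by (simp add: sth_largest_def norm0_pos_part)
  have len: "length ?xs = CARD('a)"
    by (metis mset_rev mset_sorted_list_of_multiset size_image_mset size_mset size_mset_set)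
  have s_le: "s \<le> CARD('a)" using card by (metis card_mono finite subset_UNIV)
  have "y $ j < ?xs ! k" if "k < s" for k
  proof -
    have "?xs ! (s - 1) \<le> ?xs ! k"
      using that s_le by (intro sorted_rev_nth_mono) (auto simp: len simp del: length_rev)
    with gt show ?thesis by simp
  qed
  then have "{..<s} \<subseteq> {k. k < length ?xs \<and> y $ j < ?xs ! k}"
    using s_le len by auto
  then have "card {..<s} \<le> card {k. k < length ?xs \<and> y $ j < ?xs ! k}"
    by (intro card_mono) auto
  also have "\<dots> = size (filter_mset (\<lambda>a. y $ j < a) (mset ?xs))"
    by (metis length_filter_conv_card mset_filter size_mset)
  also have "\<dots> = card {i. y $ j < pos_part y $ i}"
    by (simp add: filter_mset_image_mset)
  also have "\<dots> \<le> card ({i. 0 < y $ i} - {j})"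
    using pos by (intro card_mono) (auto simp: pos_part_def max_def split: if_splits)
  also have "\<dots> = s - 1" using card pos by simp
  finally show False using \<open>0 < s\<close> by simp
qed

text \<open>For \<open>l \<noteq> 0\<close> exactly \<open>s\<close> entries of \<open>Ax - b\<close> are positive, so that the numerator of \<open>\<tau>\<^sub>*\<close> is a lower
  bound for all of them.\<close>

lemma tau_star_gap:
  assumes opt: "A *v x - b \<in> proj_S s (A *v x - b + \<tau> *\<^sub>R l)" and "0 < \<tau>" "0 < s"
    and \<tau>: "ereal \<tau> < tau_star A b s (x, l)"
    and pos: "0 < (A *v x - b) $ j"
  shows "\<tau> * l $ i < (A *v x - b) $ j"
proof (cases "l = 0")
  case True
  with pos show ?thesis by simp
next
  case False
  let ?y = "A *v x - b" and ?m = "Max (range (($) l))"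
  note mult = proj_S_multiplier[OF opt \<open>0 < \<tau>\<close>]
  have card: "card {i. 0 < ?y $ i} = s" using mult(1,4) False by linarith
  have le: "l $ k \<le> ?m" for k by simp
  obtain k where "l $ k \<noteq> 0" using False by (auto simp: vec_eq_iff)
  then have "0 < ?m" using mult(3)[of k] le[of k] by linarith
  have "\<tau> < sth_largest s ?y / ?m" using \<tau> False by (simp add: tau_star_def)
  then have "\<tau> * ?m < sth_largest s ?y" using \<open>0 < ?m\<close> by (simp add: pos_less_divide_eq)
  also have "\<dots> \<le> ?y $ j" by (rule sth_largest_le_positive_entry[OF card \<open>0 < s\<close> pos])
  finally show ?thesis using le[of i] \<open>0 < \<tau>\<close> by (meson mult_left_mono le_less_trans less_imp_le)
qed

text \<open>Only the signs and the strict comparisons of the entries of \<open>y + \<tau>l\<close> matter, and these persist for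
  nearby \<open>z\<close>. If \<open>T\<close> contained an index with \<open>y\<^sub>i > 0\<close>, then the kept set \<open>G\<close> would consist of indices whose
  entries of \<open>z\<close> are at least \<open>z\<^sub>i\<close>, hence be a proper subset of \<open>{j. y\<^sub>j > 0}\<close>, and would be too small. If \<open>l \<noteq> 0\<close>,
  then \<open>{j. y\<^sub>j > 0}\<close> already has \<open>s\<close> elements and fills \<open>G\<close>, so that every index with \<open>l\<^sub>i > 0\<close> must
  belong to \<open>T\<close>.\<close>

lemma eventually_T_sets_active:
  fixes y l :: "real^'m" and \<tau> :: real
  assumes "0 < \<tau>" and card_le: "card {i. 0 < y $ i} \<le> s"
    and off: "\<And>i. y $ i \<noteq> 0 \<Longrightarrow> l $ i = 0"
    and nonneg: "\<And>i. 0 \<le> l $ i"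
    and slack: "card {i. 0 < y $ i} < s \<Longrightarrow> l = 0"
    and gap: "\<And>i j. 0 < y $ j \<Longrightarrow> \<tau> * l $ i < y $ j"
  shows "\<forall>\<^sub>F z in nhds (y + \<tau> *\<^sub>R l). \<forall>T\<in>T_sets z s. T \<subseteq> {i. y $ i = 0} \<and> (\<forall>i. i \<notin> T \<longrightarrow> l $ i = 0)"
proof -
  let ?z = "y + \<tau> *\<^sub>R l"
  let ?P = "{i. 0 < y $ i}"
  have lim: "((\<lambda>z. z $ i) \<longlongrightarrow> ?z $ i) (nhds ?z)" for i
    by (intro tendsto_vec_nth filterlim_ident)
  have pos: "\<forall>\<^sub>F z in nhds ?z. \<forall>i. 0 < ?z $ i \<longrightarrow> 0 < z $ i"
    by (intro eventually_all_finite) (use order_tendstoD(1)[OF lim] in auto)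
  have neg: "\<forall>\<^sub>F z in nhds ?z. \<forall>i. ?z $ i < 0 \<longrightarrow> z $ i < 0"
    by (intro eventually_all_finite) (use order_tendstoD(2)[OF lim] in auto)
  have sep: "\<forall>\<^sub>F z in nhds ?z. \<forall>i j. ?z $ i < ?z $ j \<longrightarrow> z $ i < z $ j"
  proof (intro eventually_all_finite)
    fix i j
    have "((\<lambda>z. z $ j - z $ i) \<longlongrightarrow> ?z $ j - ?z $ i) (nhds ?z)"
      by (intro tendsto_diff lim)
    from order_tendstoD(1)[OF this, of 0]
    show "\<forall>\<^sub>F z in nhds ?z. ?z $ i < ?z $ j \<longrightarrow> z $ i < z $ j"
      by (cases "?z $ i < ?z $ j") auto
  qed
  from pos neg sep show ?thesis
  proof eventually_elim
    case (elim z)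
    show ?case
    proof
      fix T assume "T \<in> T_sets z s"
      then obtain G where G: "G \<subseteq> {i. z $ i > 0}" "card G = min s (card {i. z $ i > 0})"
        and T: "T = ({i. z $ i > 0} - G) \<union> {i. z $ i = 0}"
        and ord: "\<And>i j. i \<in> G \<Longrightarrow> j \<in> T \<Longrightarrow> z $ j \<le> z $ i"
        unfolding T_sets_def by blast
      have P_pos: "?P \<subseteq> {i. z $ i > 0}" using elim(1) off by auto
      have "card ?P \<le> card {i. z $ i > 0}" using P_pos by (intro card_mono) auto
      then have card_G: "card ?P \<le> card G" using card_le G(2) by simp
      have no_neg: "0 \<le> y $ i" if "i \<in> T" for i
      proof (rule ccontr)
        assume "\<not> ?thesis"
        then have "z $ i < 0" using elim(2) off[of i] by simp
        with that T show False by auto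
      qed
      have zero_of_pos: "i \<in> ?P \<or> y $ i = 0" if "0 < z $ i" for i
        using elim(2)[rule_format, of i] off[of i] that by force
      have no_pos: "i \<notin> ?P" if "i \<in> T" for i
      proof
        assume i: "i \<in> ?P"
        have "G \<subseteq> ?P"
        proof
          fix k assume k: "k \<in> G"
          show "k \<in> ?P"
          proof (rule ccontr)
            assume "k \<notin> ?P"
            then have "y $ k = 0" using zero_of_pos[of k] G(1) k by auto
            then have "?z $ k < ?z $ i" using gap[of i k] i off[of i] by simp
            then have "z $ k < z $ i" using elim(3) by blast
            with ord[OF k that] show False by simp
          qed
        qed
        moreover have "i \<notin> G" using that T i P_pos by auto
        ultimately have "G \<subset> ?P" using i by blast
        then have "card G < card ?P" by (intro psubset_card_mono) auto
        with card_G show False by simp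
      qed
      have "y $ i = 0" if "i \<in> T" for i using no_neg[OF that] no_pos[OF that] by auto
      then have "T \<subseteq> {i. y $ i = 0}" by blast
      moreover have "l $ i = 0" if "i \<notin> T" for i
      proof (cases "l = 0")
        case False
        then have "card ?P = s" using slack card_le by linarith
        moreover have "card G \<le> s" using G(2) by simp
        moreover have "?P \<subseteq> G" using no_pos P_pos T by blast
        ultimately have "G = ?P" by (metis card_seteq finite)
        show ?thesis
        proof (rule ccontr)
          assume "l $ i \<noteq> 0"
          then have "y $ i = 0" "0 < l $ i" using off[of i] nonneg[of i] by auto
          then have "0 < z $ i" using elim(1) \<open>0 < \<tau>\<close> by simp
          then have "i \<in> T" using T \<open>G = ?P\<close> \<open>y $ i = 0\<close> by simp
          with that show False ..
        qed
      qed simp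
      ultimately show "T \<subseteq> {i. y $ i = 0} \<and> (\<forall>i. i \<notin> T \<longrightarrow> l $ i = 0)" by blast
    qed
  qed
qed

section \<open>First-order expansion of the gradient\<close>

text \<open>Along the segment from \<open>x\<close> to \<open>p\<close> the remainder has derivative of norm at most
  \<open>L t \<parallel>p - x\<parallel>\<^sup>2\<close>. Comparing with the antiderivative \<open>L/2 \<parallel>p - x\<parallel>\<^sup>2 t\<^sup>2\<close> gives the constant \<open>L/2\<close>, whereas the
  mean value inequality would only give \<open>L\<close>.\<close>

lemma taylor_remainder_Lipschitz_derivative:
  fixes g :: "'a::real_normed_vector \<Rightarrow> 'b::real_normed_vector"
  assumes "convex S" "x \<in> S" "p \<in> S"
    and deriv: "\<And>y. y \<in> S \<Longrightarrow> (g has_derivative G y) (at y)"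
    and lip: "\<And>y h. y \<in> S \<Longrightarrow> norm (G y h - G x h) \<le> L * norm (y - x) * norm h"
  shows "norm (g p - g x - G x (p - x)) \<le> L / 2 * (norm (p - x))\<^sup>2"
proof -
  let ?h = "p - x"
  let ?c = "\<lambda>t. x + t *\<^sub>R ?h"
  let ?\<phi> = "\<lambda>t. g (?c t) - t *\<^sub>R G x ?h"
  let ?\<psi> = "\<lambda>t. L / 2 * (norm ?h)\<^sup>2 * t\<^sup>2"
  have mem: "?c t \<in> S" if "0 \<le> t" "t \<le> 1" for t
  proof -
    have "?c t = (1 - t) *\<^sub>R x + t *\<^sub>R p" by (simp add: algebra_simps)
    then show ?thesis using assms(1-3) that by (simp add: convex_alt)
  qed
  have \<phi>': "(?\<phi> has_vector_derivative (G (?c t) ?h - G x ?h)) (at t)" if "0 \<le> t" "t \<le> 1" for t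
  proof -
    have lin: "linear (G (?c t))" using deriv[OF mem[OF that]] has_derivative_linear by blast
    have "(?c has_derivative (\<lambda>r. r *\<^sub>R ?h)) (at t)" by (auto intro!: derivative_eq_intros)
    from has_derivative_compose[OF this deriv[OF mem[OF that]]]
    have "((\<lambda>t. g (?c t)) has_derivative (\<lambda>r. r *\<^sub>R G (?c t) ?h)) (at t)"
      by (simp add: linear_scale[OF lin])
    then have "((\<lambda>t. g (?c t)) has_vector_derivative G (?c t) ?h) (at t)"
      by (simp add: has_vector_derivative_def)
    then show ?thesis by (auto intro!: derivative_eq_intros)
  qed
  have "norm (?\<phi> 1 - ?\<phi> 0) \<le> ?\<psi> 1 - ?\<psi> 0"
  proof (rule differentiable_bound_general[where f' = "\<lambda>t. G (?c t) ?h - G x ?h"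
        and \<phi>' = "\<lambda>t. L * t * (norm ?h)\<^sup>2"])
    show "continuous_on {0..1} ?\<phi>"
      by (rule continuous_at_imp_continuous_on) (auto intro: has_vector_derivative_continuous[OF \<phi>'])
    show "continuous_on {0..1} ?\<psi>" by (intro continuous_intros)
    fix t :: real assume t: "0 < t" "t < 1"
    show "(?\<phi> has_vector_derivative (G (?c t) ?h - G x ?h)) (at t)" using t by (intro \<phi>') auto
    show "(?\<psi> has_vector_derivative L * t * (norm ?h)\<^sup>2) (at t)"
      by (auto intro!: derivative_eq_intros simp flip: has_real_derivative_iff_has_vector_derivative)
    have "norm (G (?c t) ?h - G x ?h) \<le> L * norm (?c t - x) * norm ?h"
      using t by (intro lip mem) auto
    then show "norm (G (?c t) ?h - G x ?h) \<le> L * t * (norm ?h)\<^sup>2"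
      using t by (simp add: power2_eq_square mult.assoc)
  qed simp
  then show ?thesis by (simp add: algebra_simps)
qed

lemma norm_matrix_vector_le_spectral_norm: "norm (M *v u) \<le> spectral_norm M * norm u"
  unfolding spectral_norm_def by (rule onorm[OF matrix_vector_mul_bounded_linear])

lemma C2_gradient_has_derivative:
  assumes "C2 f"
  shows "(gradient f has_derivative (\<lambda>h. hessian f x *v h)) (at x)"
  using assms unfolding C2_def hessian_def by (metis jacobian_works)

section \<open>One Newton step\<close>

lemma newton_system_iff:
  "newton_system f A b T (x, l) e \<longleftrightarrow>
   newton_operator (hessian f x) A T e =
     - (gradient f x + (\<Sum>i\<in>T. l $ i *\<^sub>R row i A), \<chi> i. if i \<in> T then (A *v x - b) $ i else l $ i)"
  by (cases e) (auto simp: newton_system_def newton_operator_def vec_eq_iff uminus_prod_def)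

lemma transpose_mult_eq_sum_rows:
  fixes A :: "real^'n^'m"
  assumes "\<And>i. i \<notin> T \<Longrightarrow> l $ i = 0"
  shows "transpose A *v l = (\<Sum>i\<in>T. l $ i *\<^sub>R row i A)"
proof (rule vec_eq_iff[THEN iffD2], rule allI)
  fix k
  have "(transpose A *v l) $ k = (\<Sum>i\<in>UNIV. A $ i $ k * l $ i)"
    by (simp add: matrix_vector_mult_def transpose_def)
  also have "\<dots> = (\<Sum>i\<in>T. A $ i $ k * l $ i)"
    by (rule sum.mono_neutral_right) (use assms in auto)
  finally show "(transpose A *v l) $ k = (\<Sum>i\<in>T. l $ i *\<^sub>R row i A) $ k"
    by (simp add: row_def mult.commute)
qed

text \<open>\<open>(xs, ls)\<close> solves the system for \<open>T\<close>, and all terms except the gradient are affine in \<open>(x, l)\<close>, so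
  they cancel exactly.\<close>

lemma newton_operator_error:
  assumes newton: "newton_system f A b T (x, l) e"
    and stat: "gradient f xs + transpose A *v ls = 0"
    and active: "T \<subseteq> zero_set A b xs" and off: "\<And>i. i \<notin> T \<Longrightarrow> ls $ i = 0"
  shows "newton_operator (hessian f x) A T ((x, l) + e - (xs, ls)) =
    (gradient f xs - gradient f x - hessian f x *v (xs - x), 0)"
proof -
  let ?N = "newton_operator (hessian f x) A T"
  have "?N ((x, l) + e - (xs, ls)) = ?N e - ?N (xs - x, ls - l)"
  proof -
    have "(x, l) + e - (xs, ls) = e - (xs - x, ls - l)" by (simp add: prod_eq_iff algebra_simps)
    then show ?thesis by (simp only: linear_diff[OF linear_newton_operator])
  qed
  also have "\<dots> = (gradient f xs - gradient f x - hessian f x *v (xs - x), 0)"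
  proof (rule prod_eqI)
    have "gradient f xs = - (\<Sum>i\<in>T. ls $ i *\<^sub>R row i A)"
      using stat by (simp only: transpose_mult_eq_sum_rows[OF off] eq_neg_iff_add_eq_0)
    then show "fst (?N e - ?N (xs - x, ls - l)) = fst (gradient f xs - gradient f x - hessian f x *v (xs - x), 0 :: real^'b)"
      using newton unfolding newton_system_iff
      by (simp add: newton_operator_def scaleR_left_diff_distrib sum_subtractf)
    show "snd (?N e - ?N (xs - x, ls - l)) = snd (gradient f xs - gradient f x - hessian f x *v (xs - x), 0 :: real^'b)"
      using newton active off unfolding newton_system_iff
      by (auto simp: newton_operator_def vec_eq_iff zero_set_def matrix_vector_mult_diff_distrib subset_iff)
  qed
  finally show ?thesis .
qed

lemma newton_system_unique_solution:
  assumes "0 < \<mu>" and lower: "\<And>e. \<mu> * norm e \<le> norm (newton_operator (hessian f (fst w)) A T e)"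
  shows "\<exists>!e. newton_system f A b T w e"
proof -
  obtain x l where w: "w = (x, l)" by (cases w)
  let ?N = "newton_operator (hessian f x) A T"
  have "inj ?N"
    unfolding linear_injective_0[OF linear_newton_operator]
  proof (intro allI impI)
    fix e assume "?N e = 0"
    with lower[of e] w have "\<mu> * norm e \<le> 0" by simp
    with \<open>0 < \<mu>\<close> show "e = 0" by (simp add: mult_le_0_iff)
  qed
  then have "bij ?N" by (simp add: bij_def linear_injective_imp_surjective linear_newton_operator)
  then show ?thesis unfolding w newton_system_iff bij_iff by simp
qed

lemma c_star_pos:
  assumes "positive_definite (hessian f xs)" "full_row_rank_on (zero_set A b xs) A"
  shows "0 < c_star f A b xs"
proof -
  have "0 < sigma_min_H f A xs T" if "T \<subseteq> zero_set A b xs" for T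
    unfolding sigma_min_H_def using assms that by (rule sigma_min_block_matrix_pos)
  then have "0 < Min (sigma_min_H f A xs ` Pow (zero_set A b xs))"
    by (subst Min_gr_iff) auto
  then show ?thesis by (simp add: c_star_def)
qed

text \<open>By definition \<open>2/c\<^sub>*\<close> is at most \<open>1\<close> and at most \<open>\<sigma>\<^sub>m\<^sub>i\<^sub>n(H(T))\<close> for every \<open>T \<subseteq> J\<^sub>*\<close>.\<close>

lemma norm_newton_operator_ge_c_star:
  fixes A :: "real^'n^'m"
  assumes pd: "positive_definite (hessian f xs)" and rank: "full_row_rank_on (zero_set A b xs) A"
    and "T \<subseteq> zero_set A b xs"
  shows "2 / c_star f A b xs * norm e \<le> norm (newton_operator (hessian f xs) A T e)"
proof (rule norm_newton_operator_ge)
  let ?m = "Min (sigma_min_H f A xs ` Pow (zero_set A b xs))"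
  have c: "2 / c_star f A b xs = min ?m 1" by (simp add: c_star_def)
  show "0 \<le> 2 / c_star f A b xs" using c_star_pos[OF pd rank] by simp
  show "2 / c_star f A b xs \<le> 1" unfolding c by simp
  have "?m \<le> sigma_min_H f A xs T" using assms(3) by (intro Min_le) auto
  then show "2 / c_star f A b xs \<le> sigma_min (UNIV <+> T) (block_matrix (hessian f xs) A)"
    unfolding c sigma_min_H_def by simp
qed

lemma norm_newton_operator_perturbed_ge:
  fixes A :: "real^'n^'m"
  assumes lower: "2 * \<mu> * norm e \<le> norm (newton_operator Q A T e)"
    and close: "spectral_norm (Q' - Q) \<le> \<mu>"
  shows "\<mu> * norm e \<le> norm (newton_operator Q' A T e)"
proof -
  obtain u v where e: "e = (u, v)" by (cases e)
  have "newton_operator Q A T e = newton_operator Q' A T e - ((Q' - Q) *v u, 0)"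
    by (simp add: e newton_operator_def matrix_vector_mult_diff_rdistrib)
  then have "norm (newton_operator Q A T e) \<le> norm (newton_operator Q' A T e) + norm ((Q' - Q) *v u)"
    using norm_triangle_ineq4[of "newton_operator Q' A T e" "((Q' - Q) *v u, 0)"] by (simp add: norm_Pair)
  also have "norm ((Q' - Q) *v u) \<le> \<mu> * norm u"
    by (rule order_trans[OF norm_matrix_vector_le_spectral_norm])
      (use close in \<open>simp add: mult_right_mono\<close>)
  also have "\<mu> * norm u \<le> \<mu> * norm e"
  proof (rule mult_left_mono)
    show "norm u \<le> norm e" using norm_fst_le[of u v] by (simp add: e)
    have "0 \<le> spectral_norm (Q' - Q)"
      unfolding spectral_norm_def by (rule onorm_pos_le[OF matrix_vector_mul_bounded_linear])
    then show "0 \<le> \<mu>" using close by simp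
  qed
  finally show ?thesis using lower by simp
qed

text \<open>The expansion factor \<open>2/c\<^sub>*\<close> at the solution drops to \<open>1/c\<^sub>*\<close> at \<open>x\<close>, because \<open>close\<close> keeps the
  two Hessians within \<open>1/c\<^sub>*\<close> of each other. Applied to the new error, whose image is the Taylor
  remainder, it gives the quadratic bound.\<close>

lemma newton_step_quadratic:
  fixes A :: "real^'n^'m"
  assumes "C2 f" and pd: "positive_definite (hessian f xs)"
    and rank: "full_row_rank_on (zero_set A b xs) A"
    and stat: "gradient f xs + transpose A *v ls = 0"
    and "0 < L" and "convex N" "xs \<in> N" "x \<in> N"
    and lip: "\<And>y y'. y \<in> N \<Longrightarrow> y' \<in> N \<Longrightarrow> spectral_norm (hessian f y - hessian f y') \<le> L * norm (y - y')"
    and close: "c_star f A b xs * L * norm (x - xs) \<le> 1"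
    and active: "T \<subseteq> zero_set A b xs" and off: "\<And>i. i \<notin> T \<Longrightarrow> ls $ i = 0"
  shows "\<exists>!e. newton_system f A b T (x, l) e"
    and "newton_system f A b T (x, l) e \<Longrightarrow>
      norm ((x, l) + e - (xs, ls)) \<le> 0.5 * c_star f A b xs * L * (norm ((x, l) - (xs, ls)))\<^sup>2"
proof -
  let ?c = "c_star f A b xs"
  have c: "0 < ?c" using pd rank by (rule c_star_pos)
  have "spectral_norm (hessian f x - hessian f xs) \<le> L * norm (x - xs)"
    using \<open>x \<in> N\<close> \<open>xs \<in> N\<close> by (rule lip)
  also have "\<dots> \<le> 1 / ?c" using close c by (simp add: field_simps)
  finally have near: "spectral_norm (hessian f x - hessian f xs) \<le> 1 / ?c" .
  have lower: "1 / ?c * norm e \<le> norm (newton_operator (hessian f x) A T e)" for e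
    by (rule norm_newton_operator_perturbed_ge[OF _ near])
      (use norm_newton_operator_ge_c_star[OF pd rank active, of e] in simp)
  show "\<exists>!e. newton_system f A b T (x, l) e"
    by (rule newton_system_unique_solution[of "1 / ?c"]) (use c lower in auto)
  show "norm ((x, l) + e - (xs, ls)) \<le> 0.5 * ?c * L * (norm ((x, l) - (xs, ls)))\<^sup>2"
    if newton: "newton_system f A b T (x, l) e"
  proof -
    have "1 / ?c * norm ((x, l) + e - (xs, ls))
        \<le> norm (newton_operator (hessian f x) A T ((x, l) + e - (xs, ls)))"
      by (rule lower)
    also have "\<dots> = norm (gradient f xs - gradient f x - hessian f x *v (xs - x))"
      by (subst newton_operator_error[OF newton stat active off]) (simp_all add: norm_Pair)
    also have "\<dots> \<le> L / 2 * (norm (xs - x))\<^sup>2"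
    proof (rule taylor_remainder_Lipschitz_derivative[OF \<open>convex N\<close> \<open>x \<in> N\<close> \<open>xs \<in> N\<close>])
      fix y h assume "y \<in> N"
      show "(gradient f has_derivative (*v) (hessian f y)) (at y)"
        using C2_gradient_has_derivative[OF \<open>C2 f\<close>] .
      have "norm ((hessian f y - hessian f x) *v h) \<le> spectral_norm (hessian f y - hessian f x) * norm h"
        by (rule norm_matrix_vector_le_spectral_norm)
      also have "\<dots> \<le> L * norm (y - x) * norm h"
        using lip[OF \<open>y \<in> N\<close> \<open>x \<in> N\<close>] by (rule mult_right_mono) simp
      finally show "norm (hessian f y *v h - hessian f x *v h) \<le> L * norm (y - x) * norm h"
        by (simp add: matrix_vector_mult_diff_rdistrib)
    qed
    also have "\<dots> \<le> L / 2 * (norm ((x, l) - (xs, ls)))\<^sup>2"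
    proof (intro mult_left_mono power_mono)
      show "norm (xs - x) \<le> norm ((x, l) - (xs, ls))"
        using norm_fst_le[of "x - xs" "l - ls"] by (simp add: norm_minus_commute)
    qed (use \<open>0 < L\<close> in auto)
    finally show ?thesis using c by (simp add: field_simps)
  qed
qed

section \<open>Local quadratic convergence\<close>

text \<open>In a ball of radius \<open>1/(2K)\<close> the quadratic bound at least halves the error. The bound on a step is
  assumed only inside the ball, so staying inside is part of the same induction.\<close>

lemma quadratic_contraction_tendsto:
  fixes w :: "nat \<Rightarrow> 'a::real_normed_vector"
  assumes "0 < K" "0 < r" and rK: "r \<le> 1 / (2 * K)" and start: "norm (w 0 - p) < r"
    and step: "\<And>k. norm (w k - p) < r \<Longrightarrow> norm (w (Suc k) - p) \<le> K * (norm (w k - p))\<^sup>2"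
  shows "norm (w k - p) < r" and "w \<longlonglongrightarrow> p"
proof -
  have half: "norm (w (Suc k) - p) \<le> norm (w k - p) / 2" if k: "norm (w k - p) < r" for k
  proof -
    have "K * norm (w k - p) \<le> K * r" using k \<open>0 < K\<close> by simp
    also have "\<dots> \<le> 1 / 2" using rK \<open>0 < K\<close> by (simp add: field_simps)
    finally have "K * norm (w k - p) \<le> 1 / 2" .
    then have "K * norm (w k - p) * norm (w k - p) \<le> 1 / 2 * norm (w k - p)"
      by (rule mult_right_mono) simp
    with step[OF k] show ?thesis by (simp add: power2_eq_square mult.assoc)
  qed
  have bound: "norm (w k - p) < r \<and> norm (w k - p) \<le> r * (1 / 2) ^ k" for k
  proof (induction k)
    case 0
    then show ?case using start by simp
  next
    case (Suc k)
    then have "norm (w (Suc k) - p) \<le> norm (w k - p) / 2" using half by blast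
    moreover have "norm (w k - p) / 2 \<le> norm (w k - p)" by simp
    moreover have "norm (w k - p) / 2 \<le> r * (1 / 2) ^ Suc k" using Suc by simp
    ultimately show ?case using Suc by linarith
  qed
  then show "norm (w k - p) < r" by blast
  have "(\<lambda>k. (1 / 2 :: real) ^ k) \<longlonglongrightarrow> 0"
    by (rule LIMSEQ_power_zero) simp
  from tendsto_mult_left[OF this, of r]
  have geometric: "(\<lambda>k. r * (1 / 2) ^ k) \<longlonglongrightarrow> 0" by simp
  have "(\<lambda>k. w k - p) \<longlonglongrightarrow> 0"
    by (rule Lim_null_comparison[OF _ geometric]) (simp add: bound)
  then show "w \<longlonglongrightarrow> p" by (simp add: LIM_zero_cancel)
qed

theorem theorem4p2:
  fixes f :: "real^'n \<Rightarrow> real" and A :: "real^'n^'m" and b :: "real^'m"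
    and s :: nat and \<tau> L :: real and xs :: "real^'n" and ls :: "real^'m"
  assumes "C1 f"
    and "CARD('m) \<le> CARD('n)"
    and "0 < s" and "s < CARD('m)"
    and "tau_stationary f A b s \<tau> (xs, ls)"
    and "0 < \<tau>" and "ereal \<tau> < tau_star A b s (xs, ls)"
    and "C2 f"
    and "positive_definite (hessian f xs)"
    and "full_row_rank_on (zero_set A b xs) A"
    and "0 < L"
    and "\<exists>N. open N \<and> xs \<in> N \<and>
           (\<forall>x\<in>N. \<forall>x'\<in>N. spectral_norm (hessian f x - hessian f x') \<le> L * norm (x - x'))"
  shows "\<exists>\<delta>>0. \<forall>w T d.
           w 0 \<in> ball (xs, ls) (min \<delta> (1 / (c_star f A b xs * L))) \<longrightarrow>
           NHS_run f A b s \<tau> w T d \<longrightarrow>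
             (\<forall>k. \<exists>!e. newton_system f A b (T k) (w k) e) \<and>
             d \<longlonglongrightarrow> 0 \<and>
             w \<longlonglongrightarrow> (xs, ls) \<and>
             (\<forall>k. norm (w (Suc k) - (xs, ls))
                    \<le> 0.5 * c_star f A b xs * L * (norm (w k - (xs, ls)))\<^sup>2)"
proof -
  let ?c = "c_star f A b xs" and ?ws = "(xs, ls)" and ?y = "A *v xs - b"
  let ?z = "\<lambda>w. A *v fst w - b + \<tau> *\<^sub>R snd w"
  have stat: "gradient f xs + transpose A *v ls = 0" and proj: "?y \<in> proj_S s (?y + \<tau> *\<^sub>R ls)"
    using assms(5) by (auto simp: tau_stationary_def)
  note mult = proj_S_multiplier[OF proj \<open>0 < \<tau>\<close>]
  have c: "0 < ?c" using assms(9,10) by (rule c_star_pos)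
  have "\<forall>\<^sub>F z in nhds (?z ?ws). \<forall>T\<in>T_sets z s. T \<subseteq> zero_set A b xs \<and> (\<forall>i. i \<notin> T \<longrightarrow> ls $ i = 0)"
    using eventually_T_sets_active[OF \<open>0 < \<tau>\<close> mult(1) mult(2) mult(3) mult(4)
        tau_star_gap[OF proj \<open>0 < \<tau>\<close> \<open>0 < s\<close> assms(7)]]
    by (simp add: zero_set_def)
  moreover have "filterlim ?z (nhds (?z ?ws)) (nhds ?ws)"
    by (intro tendsto_intros bounded_linear.tendsto[OF matrix_vector_mul_bounded_linear] filterlim_ident)
  ultimately have "\<forall>\<^sub>F w in nhds ?ws. \<forall>T\<in>T_sets (?z w) s.
      T \<subseteq> zero_set A b xs \<and> (\<forall>i. i \<notin> T \<longrightarrow> ls $ i = 0)"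
    by (rule eventually_compose_filterlim)
  then obtain \<delta>1 where "0 < \<delta>1" and \<delta>1: "\<forall>w. dist w ?ws < \<delta>1 \<longrightarrow>
      (\<forall>T\<in>T_sets (?z w) s. T \<subseteq> zero_set A b xs \<and> (\<forall>i. i \<notin> T \<longrightarrow> ls $ i = 0))"
    unfolding eventually_nhds_metric by (elim exE conjE)
  obtain N where "open N" "xs \<in> N" and lip_N:
      "\<forall>x\<in>N. \<forall>x'\<in>N. spectral_norm (hessian f x - hessian f x') \<le> L * norm (x - x')"
    using assms(12) by (elim exE conjE)
  then obtain \<delta>2 where "0 < \<delta>2" and ball_N: "ball xs \<delta>2 \<subseteq> N"
    by (auto elim: openE)
  then have lip: "spectral_norm (hessian f x - hessian f x') \<le> L * norm (x - x')"
    if "x \<in> ball xs \<delta>2" "x' \<in> ball xs \<delta>2" for x x'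
    using lip_N that by (simp add: subset_iff)
  define \<delta> where "\<delta> = min \<delta>1 \<delta>2"
  have "0 < \<delta>" using \<open>0 < \<delta>1\<close> \<open>0 < \<delta>2\<close> by (simp add: \<delta>_def)
  define r where "r = min \<delta> (1 / (?c * L))"
  have "0 < r" using \<open>0 < \<delta>\<close> c \<open>0 < L\<close> by (simp add: r_def)
  have step: "(\<exists>!e. newton_system f A b T w e) \<and> (\<forall>e. newton_system f A b T w e \<longrightarrow>
      norm (w + e - ?ws) \<le> 0.5 * ?c * L * (norm (w - ?ws))\<^sup>2)"
    if w: "norm (w - ?ws) < r" and T: "T \<in> T_sets (?z w) s" for w T
  proof -
    obtain x l where wxl: "w = (x, l)" by (cases w)
    have act: "T \<subseteq> zero_set A b xs" "\<And>i. i \<notin> T \<Longrightarrow> ls $ i = 0"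
      using \<delta>1[rule_format, OF _ T] w by (simp_all add: r_def \<delta>_def dist_norm)
    have "norm (x - xs) < r"
      using norm_fst_le[of "x - xs" "l - ls"] w by (simp add: wxl)
    then have "x \<in> ball xs \<delta>2" and "norm (x - xs) < 1 / (?c * L)"
      by (simp_all add: r_def \<delta>_def dist_norm norm_minus_commute)
    moreover from this(2) have close: "?c * L * norm (x - xs) \<le> 1"
      using c \<open>0 < L\<close> by (simp add: pos_less_divide_eq mult.commute)
    moreover have "xs \<in> ball xs \<delta>2" using \<open>0 < \<delta>2\<close> by simp
    ultimately show ?thesis unfolding wxl
      by (intro conjI allI impI newton_step_quadratic[OF assms(8-10) stat \<open>0 < L\<close> convex_ball _ _ lip close act])
  qed
  show ?thesis
  proof (intro exI[of _ \<delta>] conjI allI impI \<open>0 < \<delta>\<close>)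
    fix w :: "nat \<Rightarrow> (real^'n) \<times> (real^'m)" and T d
    assume start: "w 0 \<in> ball ?ws (min \<delta> (1 / (?c * L)))" and run: "NHS_run f A b s \<tau> w T d"
    have T: "T k \<in> T_sets (?z (w k)) s" and d: "d k = (THE e. newton_system f A b (T k) (w k) e)"
      and w_Suc: "w (Suc k) = w k + d k" for k
      using run by (auto simp: NHS_run_def)
    have error: "norm (w (Suc k) - ?ws) \<le> (0.5 * ?c * L) * (norm (w k - ?ws))\<^sup>2"
      if "norm (w k - ?ws) < r" for k
    proof -
      have "newton_system f A b (T k) (w k) (d k)"
        unfolding d by (rule theI'[OF step[OF that T, THEN conjunct1]])
      then show ?thesis
        unfolding w_Suc by (rule step[OF that T, THEN conjunct2, rule_format])
    qed
    have start': "norm (w 0 - ?ws) < r"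
      using start by (simp add: r_def dist_norm norm_minus_commute)
    have r_le: "r \<le> 1 / (2 * (0.5 * ?c * L))" by (simp add: r_def)
    have K: "0 < 0.5 * ?c * L" using c \<open>0 < L\<close> by simp
    note conv = quadratic_contraction_tendsto[where w=w and p="?ws" and K="0.5 * ?c * L",
        OF K \<open>0 < r\<close> r_le start' error]
    have near: "norm (w k - ?ws) < r" for k by (rule conv(1))
    have lim: "w \<longlonglongrightarrow> ?ws" by (rule conv(2))
    show "\<exists>!e. newton_system f A b (T k) (w k) e" for k
      by (rule step[OF near T, THEN conjunct1])
    show "w \<longlonglongrightarrow> ?ws" by (rule lim)
    show "norm (w (Suc k) - ?ws) \<le> 0.5 * ?c * L * (norm (w k - ?ws))\<^sup>2" for k
      using error[OF near] .
    have "(\<lambda>k. w (Suc k) - w k) \<longlonglongrightarrow> ?ws - ?ws"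
      by (intro tendsto_diff LIMSEQ_Suc lim)
    then show "d \<longlonglongrightarrow> 0" by (simp add: w_Suc)
  qed
qed

end
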